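(* Let $X$ and $Y$ be compact metric spaces and let $T_1:X\times Y\to X$ and $T_2:X\times Y\to Y$ be continuous. Let $C(X,Y)$ be the set of continuous functions from $X\times Y$ to $\mathbb{R}_+$ with the uniform norm. Then the set of functions $c\in C(X,Y)$ having a unique optimal plan in $\Pi(T)$ is generic in $C(X,Y)$. The same is true for the Banach space $H(X,Y)$ of Lipschitz functions on $X\times Y$ with the usual norm: the set of $c\in H(X,Y)$ having a unique optimal plan in $\Pi(T)$ is generic in $H(X,Y)$.
   Context: $\Pi(T)$ is the set of Borel probability measures $\pi$ on $X\times Y$ such that $\int f(x)\,d\pi(x,y)=\int f(T_1(x,y))\,d\pi(x,y)$ and $\int g(y)\,d\pi(x,y)=\int g(T_2(x,y))\,d\pi(x,y)$ for all continuous $f:X\to\mathbb{R}$ and $g:Y\to\mathbb{R}$. An optimal plan for $c$ in $\Pi(T)$ is a $\pi\in\Pi(T)$ with $\int c\,d\pi=\inf_{\pi'\in\Pi(T)}\int c\,d\pi'$. $\mathbb{R}_+=[0,+\infty)$. A subset is generic if it contains a countable intersection of open dense sets. $H(X,Y)$ is the space of Lipschitz functions $c:X\times Y\to\mathbb{R}$ with norm $\|c\|_\infty+\mathrm{Lip}(c)$, where $\mathrm{Lip}(c)$ is the least Lipschitz constant with respect to the sum metric on $X\times Y$. *)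

theory Defs
  imports "HOL-Probability.Probability"
begin

section \<open>Plans\<close>

definition invariant_plans ::
    "('a::metric_space \<times> 'b::metric_space \<Rightarrow> 'a) \<Rightarrow> ('a \<times> 'b \<Rightarrow> 'b) \<Rightarrow> ('a \<times> 'b) measure set"
  where
  "invariant_plans T1 T2 = {\<pi>. prob_space \<pi> \<and> sets \<pi> = sets borel \<and>
     (\<forall>f :: 'a \<Rightarrow> real. continuous_on UNIV f \<longrightarrow> (LINT z|\<pi>. f (fst z)) = (LINT z|\<pi>. f (T1 z))) \<and>
     (\<forall>g :: 'b \<Rightarrow> real. continuous_on UNIV g \<longrightarrow> (LINT z|\<pi>. g (snd z)) = (LINT z|\<pi>. g (T2 z)))}"

definition optimal_plan ::
    "('a::metric_space \<times> 'b::metric_space \<Rightarrow> 'a) \<Rightarrow> ('a \<times> 'b \<Rightarrow> 'b) \<Rightarrow> ('a \<times> 'b \<Rightarrow> real)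
      \<Rightarrow> ('a \<times> 'b) measure \<Rightarrow> bool"
  where
  "optimal_plan T1 T2 c \<pi> \<longleftrightarrow> \<pi> \<in> invariant_plans T1 T2 \<and>
     (LINT z|\<pi>. c z) = (INF \<pi>'\<in>invariant_plans T1 T2. LINT z|\<pi>'. c z)"

section \<open>Generic subsets\<close>

text \<open>The intersection with the whole space only matters for the empty family.\<close>

definition generic_in :: "'a topology \<Rightarrow> 'a set \<Rightarrow> bool" where
  "generic_in X S \<longleftrightarrow> S \<subseteq> topspace X \<and>
     (\<exists>\<U>. countable \<U> \<and> (\<forall>U\<in>\<U>. openin X U \<and> X closure_of U = topspace X) \<and>
        topspace X \<inter> \<Inter>\<U> \<subseteq> S)"

section \<open>Nonnegative continuous functions\<close>

text \<open>On a compact space every continuous function is bounded, so the library type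
  of bounded continuous functions, whose norm is the uniform norm, contains all of them.\<close>

lemma bcontfun_compact:
  fixes f :: "'a::metric_space \<times> 'b::metric_space \<Rightarrow> real"
  assumes "compact (UNIV :: 'a set)" and "compact (UNIV :: 'b set)"
  shows "f \<in> bcontfun \<longleftrightarrow> continuous_on UNIV f"
proof -
  have "compact (UNIV :: ('a \<times> 'b) set)"
    using compact_Times[OF assms] by simp
  then show ?thesis
    by (auto simp: bcontfun_def intro: compact_imp_bounded compact_continuous_image)
qed

definition nonneg_contfun :: "('a::topological_space \<Rightarrow>\<^sub>C real) set" where
  "nonneg_contfun = {c. \<forall>z. 0 \<le> apply_bcontfun c z}"

section \<open>Lipschitz functions on a product\<close>

text \<open>The library metric on a product type is the Euclidean one, so the Lipschitz condition
  for the sum metric is written out.\<close>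

definition sum_lipschitz :: "real \<Rightarrow> ('a::metric_space \<times> 'b::metric_space \<Rightarrow> real) \<Rightarrow> bool" where
  "sum_lipschitz L c \<longleftrightarrow> 0 \<le> L \<and>
     (\<forall>x y x' y'. \<bar>c (x, y) - c (x', y')\<bar> \<le> L * (dist x x' + dist y y'))"

definition sum_lip_const :: "('a::metric_space \<times> 'b::metric_space \<Rightarrow> real) \<Rightarrow> real" where
  "sum_lip_const c = Inf {L. sum_lipschitz L c}"

definition lip_norm :: "('a::metric_space \<times> 'b::metric_space \<Rightarrow> real) \<Rightarrow> real" where
  "lip_norm c = (SUP z. \<bar>c z\<bar>) + sum_lip_const c"

text \<open>Boundedness is automatic on compact spaces (\<open>blip_compact\<close> below); requiring it in
  general makes the norm finite without a compactness assumption on the types.\<close>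

definition blip :: "('a::metric_space \<times> 'b::metric_space \<Rightarrow> real) set" where
  "blip = {c. bounded (range c) \<and> (\<exists>L. sum_lipschitz L c)}"

lemma sum_lipschitz_continuous:
  assumes "sum_lipschitz L c"
  shows "continuous_on UNIV c"
proof -
  have "(c \<longlongrightarrow> c z) (at z)" for z
  proof (rule Lim_null[THEN iffD2], rule Lim_null_comparison)
    show "\<forall>\<^sub>F w in at z. norm (c w - c z) \<le> L * (dist (fst w) (fst z) + dist (snd w) (snd z))"
      using assms by (cases z; intro always_eventually) (auto simp: sum_lipschitz_def)
    have "((\<lambda>w. L * (dist (fst w) (fst z) + dist (snd w) (snd z))) \<longlongrightarrow>
        L * (dist (fst z) (fst z) + dist (snd z) (snd z))) (at z)"
      by (intro tendsto_intros)
    then show "((\<lambda>w. L * (dist (fst w) (fst z) + dist (snd w) (snd z))) \<longlongrightarrow> 0) (at z)"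
      by simp
  qed
  then show ?thesis
    by (simp add: continuous_on_def)
qed

lemma blip_compact:
  fixes c :: "'a::metric_space \<times> 'b::metric_space \<Rightarrow> real"
  assumes "compact (UNIV :: 'a set)" and "compact (UNIV :: 'b set)"
  shows "c \<in> blip \<longleftrightarrow> (\<exists>L. sum_lipschitz L c)"
  using bcontfun_compact[OF assms, of c] sum_lipschitz_continuous[of _ c]
  by (auto simp: blip_def bcontfun_def)

lemma sum_lip_const_le: "sum_lipschitz L c \<Longrightarrow> sum_lip_const c \<le> L"
  unfolding sum_lip_const_def
  by (rule cInf_lower) (auto simp: sum_lipschitz_def bdd_below_def)

lemma sum_lip_const_attained:
  assumes "sum_lipschitz L c"
  shows "sum_lipschitz (sum_lip_const c) c"
proof -
  have ne: "{L. sum_lipschitz L c} \<noteq> {}" using assms by auto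
  have "0 \<le> sum_lip_const c"
    unfolding sum_lip_const_def using ne by (rule cInf_greatest) (auto simp: sum_lipschitz_def)
  moreover have "\<bar>c (x, y) - c (x', y')\<bar> \<le> sum_lip_const c * (dist x x' + dist y y')" for x y x' y'
  proof (cases "dist x x' + dist y y' = 0")
    case True
    then have "dist x x' = 0" "dist y y' = 0"
      by (simp_all add: add_nonneg_eq_0_iff)
    then show ?thesis by simp
  next
    case False
    then have pos: "0 < dist x x' + dist y y'"
      by (metis add_nonneg_nonneg less_eq_real_def zero_le_dist)
    have "\<bar>c (x, y) - c (x', y')\<bar> / (dist x x' + dist y y') \<le> sum_lip_const c"
      unfolding sum_lip_const_def using ne
      by (rule cInf_greatest) (use pos in \<open>auto simp: sum_lipschitz_def pos_divide_le_eq\<close>)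
    then show ?thesis using pos by (simp add: pos_divide_le_eq)
  qed
  ultimately show ?thesis by (simp add: sum_lipschitz_def)
qed

lemma sum_lip_const_nonneg: "sum_lipschitz L c \<Longrightarrow> 0 \<le> sum_lip_const c"
  using sum_lip_const_attained by (auto simp: sum_lipschitz_def)

lemma sum_lipschitz_add:
  assumes "sum_lipschitz L c" "sum_lipschitz M d"
  shows "sum_lipschitz (L + M) (\<lambda>z. c z + d z)"
  unfolding sum_lipschitz_def
proof (intro conjI allI)
  show "0 \<le> L + M" using assms by (auto simp: sum_lipschitz_def)
  fix x y x' y'
  have "\<bar>c (x, y) - c (x', y')\<bar> \<le> L * (dist x x' + dist y y')"
    "\<bar>d (x, y) - d (x', y')\<bar> \<le> M * (dist x x' + dist y y')"
    using assms by (auto simp: sum_lipschitz_def)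
  then show "\<bar>c (x, y) + d (x, y) - (c (x', y') + d (x', y'))\<bar> \<le> (L + M) * (dist x x' + dist y y')"
    unfolding distrib_right[of L M] by linarith
qed

lemma sum_lipschitz_scale:
  assumes "sum_lipschitz L c"
  shows "sum_lipschitz (\<bar>a\<bar> * L) (\<lambda>z. a * c z)"
  unfolding sum_lipschitz_def
proof (intro conjI allI)
  show "0 \<le> \<bar>a\<bar> * L" using assms by (auto simp: sum_lipschitz_def)
  fix x y x' y'
  have "\<bar>a\<bar> * \<bar>c (x, y) - c (x', y')\<bar> \<le> \<bar>a\<bar> * (L * (dist x x' + dist y y'))"
    using assms by (intro mult_left_mono) (auto simp: sum_lipschitz_def)
  then show "\<bar>a * c (x, y) - a * c (x', y')\<bar> \<le> \<bar>a\<bar> * L * (dist x x' + dist y y')"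
    by (simp add: abs_mult[symmetric] right_diff_distrib mult.assoc)
qed

lemma sum_lip_const_add:
  assumes "sum_lipschitz L c" "sum_lipschitz M d"
  shows "sum_lip_const (\<lambda>z. c z + d z) \<le> sum_lip_const c + sum_lip_const d"
  by (intro sum_lip_const_le sum_lipschitz_add sum_lip_const_attained[OF assms(1)]
      sum_lip_const_attained[OF assms(2)])

lemma sum_lipschitz_0: "sum_lipschitz 0 (\<lambda>_. 0)"
  by (simp add: sum_lipschitz_def)

lemma sum_lip_const_scale:
  assumes "sum_lipschitz L c"
  shows "sum_lip_const (\<lambda>z. a * c z) = \<bar>a\<bar> * sum_lip_const c"
proof (rule antisym)
  show *: "sum_lip_const (\<lambda>z. a * c z) \<le> \<bar>a\<bar> * sum_lip_const c"
    by (intro sum_lip_const_le sum_lipschitz_scale sum_lip_const_attained[OF assms])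
  show "\<bar>a\<bar> * sum_lip_const c \<le> sum_lip_const (\<lambda>z. a * c z)"
  proof (cases "a = 0")
    case True
    then show ?thesis
      using sum_lip_const_nonneg[OF sum_lipschitz_0] by simp
  next
    case False
    have "sum_lip_const (\<lambda>z. inverse a * (a * c z)) \<le> \<bar>inverse a\<bar> * sum_lip_const (\<lambda>z. a * c z)"
      by (intro sum_lip_const_le sum_lipschitz_scale
          sum_lip_const_attained[OF sum_lipschitz_scale[OF assms]])
    moreover have "(\<lambda>z. inverse a * (a * c z)) = c"
      using False by (simp add: field_simps)
    ultimately show ?thesis
      using False by (simp add: field_simps)
  qed
qed

lemma abs_le_SUP:
  fixes c :: "'x \<Rightarrow> real"
  assumes "bounded (range c)"
  shows "\<bar>c z\<bar> \<le> (SUP z. \<bar>c z\<bar>)"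
proof (rule cSUP_upper)
  obtain B where "\<And>z. \<bar>c z\<bar> \<le> B"
    using assms by (auto simp: bounded_iff)
  then show "bdd_above (range (\<lambda>z. \<bar>c z\<bar>))" by (auto simp: bdd_above_def)
qed simp

lemma blip_add: "c \<in> blip \<Longrightarrow> d \<in> blip \<Longrightarrow> (\<lambda>z. c z + d z) \<in> blip"
  by (auto simp: blip_def intro!: bounded_plus_comp intro: sum_lipschitz_add)

lemma blip_scale: "c \<in> blip \<Longrightarrow> (\<lambda>z. a * c z) \<in> blip"
  using bounded_scaleR_comp[of c UNIV a]
  by (auto simp: blip_def intro: sum_lipschitz_scale)

lemma blip_zero: "(\<lambda>_. 0) \<in> blip"
  by (auto simp: blip_def intro: sum_lipschitz_0)

lemma lip_norm_add:
  assumes "c \<in> blip" "d \<in> blip"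
  shows "lip_norm (\<lambda>z. c z + d z) \<le> lip_norm c + lip_norm d"
proof -
  have "(SUP z. \<bar>c z + d z\<bar>) \<le> (SUP z. \<bar>c z\<bar>) + (SUP z. \<bar>d z\<bar>)"
  proof (rule cSUP_least)
    show "\<bar>c z + d z\<bar> \<le> (SUP z. \<bar>c z\<bar>) + (SUP z. \<bar>d z\<bar>)" for z
      using abs_le_SUP[of c z] abs_le_SUP[of d z] assms by (auto simp: blip_def)
  qed simp
  moreover obtain L M where "sum_lipschitz L c" "sum_lipschitz M d"
    using assms by (auto simp: blip_def)
  ultimately show ?thesis
    unfolding lip_norm_def using sum_lip_const_add[of L c M d] by linarith
qed

lemma lip_norm_scale:
  assumes "c \<in> blip"
  shows "lip_norm (\<lambda>z. a * c z) = \<bar>a\<bar> * lip_norm c"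
proof -
  have le: "(SUP z. \<bar>b * d z\<bar>) \<le> \<bar>b\<bar> * (SUP z. \<bar>d z\<bar>)" if "d \<in> blip" for b and d :: "'a \<times> 'b \<Rightarrow> real"
  proof (rule cSUP_least)
    show "\<bar>b * d z\<bar> \<le> \<bar>b\<bar> * (SUP z. \<bar>d z\<bar>)" for z
      using abs_le_SUP[of d z] that by (auto simp: blip_def abs_mult intro: mult_left_mono)
  qed simp
  have "(SUP z. \<bar>a * c z\<bar>) = \<bar>a\<bar> * (SUP z. \<bar>c z\<bar>)"
  proof (cases "a = 0")
    case False
    have "(SUP z. \<bar>inverse a * (a * c z)\<bar>) \<le> \<bar>inverse a\<bar> * (SUP z. \<bar>a * c z\<bar>)"
      by (rule le[OF blip_scale[OF assms]])
    moreover have "(\<lambda>z. \<bar>inverse a * (a * c z)\<bar>) = (\<lambda>z. \<bar>c z\<bar>)"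
      using False by (simp add: field_simps)
    ultimately have "\<bar>a\<bar> * (SUP z. \<bar>c z\<bar>) \<le> (SUP z. \<bar>a * c z\<bar>)"
      using False by (simp add: field_simps)
    then show ?thesis using le[OF assms, of a] by linarith
  qed simp
  moreover obtain L where "sum_lipschitz L c"
    using assms by (auto simp: blip_def)
  ultimately show ?thesis
    by (simp add: lip_norm_def sum_lip_const_scale distrib_left)
qed

lemma abs_le_lip_norm:
  assumes "c \<in> blip"
  shows "\<bar>c z\<bar> \<le> lip_norm c"
  using assms abs_le_SUP[of c z] sum_lip_const_nonneg[of _ c]
  by (force simp: blip_def lip_norm_def)

lemma sum_lipschitz_lip_norm:
  assumes "c \<in> blip"
  shows "sum_lipschitz (lip_norm c) c"
proof -
  obtain L where "sum_lipschitz L c" using assms by (auto simp: blip_def)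
  from sum_lip_const_attained[OF this]
  have s: "sum_lipschitz (sum_lip_const c) c" .
  have "sum_lip_const c \<le> lip_norm c"
    using assms abs_le_SUP[of c undefined] by (auto simp: blip_def lip_norm_def)
  then show ?thesis
    using s unfolding sum_lipschitz_def
    by (meson add_nonneg_nonneg mult_right_mono order_trans zero_le_dist)
qed

lemma lip_norm_le:
  assumes "\<And>z. \<bar>c z\<bar> \<le> B" "sum_lipschitz L c"
  shows "lip_norm c \<le> B + L"
proof -
  have "(SUP z. \<bar>c z\<bar>) \<le> B" by (rule cSUP_least) (use assms in auto)
  then show ?thesis
    using sum_lip_const_le[OF assms(2)] by (simp add: lip_norm_def)
qed

subsection \<open>The Banach space of Lipschitz functions\<close>

typedef (overloaded) ('a, 'b) lipfun = "blip :: ('a::metric_space \<times> 'b::metric_space \<Rightarrow> real) set"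
  morphisms apply_lipfun Lipfun
  using blip_zero by blast

setup_lifting type_definition_lipfun

lemma lipfun_eqI: "(\<And>z. apply_lipfun c z = apply_lipfun d z) \<Longrightarrow> c = d"
  by transfer auto

instantiation lipfun :: (metric_space, metric_space) real_vector
begin

lift_definition zero_lipfun :: "('a, 'b) lipfun" is "\<lambda>_. 0"
  by (rule blip_zero)

lift_definition plus_lipfun :: "('a, 'b) lipfun \<Rightarrow> ('a, 'b) lipfun \<Rightarrow> ('a, 'b) lipfun"
  is "\<lambda>c d z. c z + d z"
  by (rule blip_add)

lift_definition scaleR_lipfun :: "real \<Rightarrow> ('a, 'b) lipfun \<Rightarrow> ('a, 'b) lipfun"
  is "\<lambda>a c z. a * c z"
  by (rule blip_scale)

lift_definition uminus_lipfun :: "('a, 'b) lipfun \<Rightarrow> ('a, 'b) lipfun" is "\<lambda>c z. - c z"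
  using blip_scale[of _ "-1"] by simp

lift_definition minus_lipfun :: "('a, 'b) lipfun \<Rightarrow> ('a, 'b) lipfun \<Rightarrow> ('a, 'b) lipfun"
  is "\<lambda>c d z. c z - d z"
  subgoal for c d using blip_add[of c "\<lambda>z. -1 * d z"] blip_scale[of d "-1"] by simp
  done

instance
  by standard (transfer; force simp: algebra_simps)+

end

instantiation lipfun :: (metric_space, metric_space) real_normed_vector
begin

lift_definition norm_lipfun :: "('a, 'b) lipfun \<Rightarrow> real" is lip_norm .

definition dist_lipfun :: "('a, 'b) lipfun \<Rightarrow> ('a, 'b) lipfun \<Rightarrow> real"
  where "dist_lipfun c d = norm (c - d)"

definition sgn_lipfun :: "('a, 'b) lipfun \<Rightarrow> ('a, 'b) lipfun"
  where "sgn_lipfun c = c /\<^sub>R norm c"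

definition uniformity_lipfun :: "(('a, 'b) lipfun \<times> ('a, 'b) lipfun) filter"
  where "uniformity_lipfun = (INF e\<in>{0 <..}. principal {(c, d). dist c d < e})"

definition open_lipfun :: "('a, 'b) lipfun set \<Rightarrow> bool"
  where "open_lipfun S = (\<forall>c\<in>S. \<forall>\<^sub>F (c', d) in uniformity. c' = c \<longrightarrow> d \<in> S)"

instance
proof
  fix c d :: "('a, 'b) lipfun" and a :: real
  show "norm (c + d) \<le> norm c + norm d"
    by transfer (rule lip_norm_add)
  show "norm (a *\<^sub>R c) = \<bar>a\<bar> * norm c"
    by transfer (rule lip_norm_scale)
  show "norm c = 0 \<longleftrightarrow> c = 0"
  proof
    show "c = 0" if "norm c = 0"
      using that
    proof transfer
      fix c :: "'a \<times> 'b \<Rightarrow> real"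
      assume "c \<in> blip" "lip_norm c = 0"
      then have "\<bar>c z\<bar> \<le> 0" for z using abs_le_lip_norm[of c z] by simp
      then show "c = (\<lambda>_. 0)" by auto
    qed
    show "norm c = 0" if "c = 0"
      unfolding that by transfer (use lip_norm_scale[OF blip_zero, of 0] in simp)
  qed
qed (simp_all add: dist_lipfun_def sgn_lipfun_def uniformity_lipfun_def open_lipfun_def)

end

instance lipfun :: (metric_space, metric_space) banach
proof
  fix X :: "nat \<Rightarrow> ('a, 'b) lipfun"
  assume X: "Cauchy X"
  have val: "\<bar>apply_lipfun c z\<bar> \<le> norm c" for c :: "('a, 'b) lipfun" and z
    by transfer (rule abs_le_lip_norm)
  have lip: "\<bar>apply_lipfun c (x, y) - apply_lipfun c (x', y')\<bar> \<le> norm c * (dist x x' + dist y y')"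
    for c :: "('a, 'b) lipfun" and x y x' y'
  proof transfer
    fix c :: "'a \<times> 'b \<Rightarrow> real" and x y x' y'
    assume "c \<in> blip"
    from sum_lipschitz_lip_norm[OF this]
    show "\<bar>c (x, y) - c (x', y')\<bar> \<le> lip_norm c * (dist x x' + dist y y')"
      unfolding sum_lipschitz_def by blast
  qed
  have minus: "apply_lipfun (c - d) z = apply_lipfun c z - apply_lipfun d z"
    for c d :: "('a, 'b) lipfun" and z
    by transfer simp
  have "convergent (\<lambda>n. apply_lipfun (X n) z)" for z
  proof (rule Cauchy_convergent, rule CauchyI)
    fix e :: real assume "0 < e"
    then obtain N where N: "\<And>m n. m \<ge> N \<Longrightarrow> n \<ge> N \<Longrightarrow> norm (X m - X n) < e"
      using CauchyD[OF X] by blast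
    then show "\<exists>N. \<forall>m\<ge>N. \<forall>n\<ge>N. norm (apply_lipfun (X m) z - apply_lipfun (X n) z) < e"
      using val[of "X _ - X _" z] unfolding minus real_norm_def by (meson le_less_trans)
  qed
  then obtain f where f: "\<And>z. (\<lambda>n. apply_lipfun (X n) z) \<longlonglongrightarrow> f z"
    unfolding convergent_def by metis
  have close: "\<bar>apply_lipfun (X m) z - f z\<bar> \<le> e"
      "sum_lipschitz e (\<lambda>z. apply_lipfun (X m) z - f z)"
    if N: "\<And>m n. m \<ge> N \<Longrightarrow> n \<ge> N \<Longrightarrow> norm (X m - X n) < e" and m: "m \<ge> N" for N e m z
  proof -
    have e: "0 \<le> e" using N[of N N] by simp
    show "\<bar>apply_lipfun (X m) z - f z\<bar> \<le> e"
    proof (rule tendsto_upperbound)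
      show "(\<lambda>n. \<bar>apply_lipfun (X m) z - apply_lipfun (X n) z\<bar>) \<longlonglongrightarrow> \<bar>apply_lipfun (X m) z - f z\<bar>"
        by (intro tendsto_intros f)
      show "\<forall>\<^sub>F n in sequentially. \<bar>apply_lipfun (X m) z - apply_lipfun (X n) z\<bar> \<le> e"
        using eventually_ge_at_top[of N]
      proof eventually_elim
        case (elim n)
        show ?case using val[of "X m - X n" z] N[OF m elim] unfolding minus by linarith
      qed
    qed simp
    have "\<bar>(apply_lipfun (X m) (x, y) - f (x, y)) - (apply_lipfun (X m) (x', y') - f (x', y'))\<bar>
        \<le> e * (dist x x' + dist y y')" for x y x' y'
    proof (rule tendsto_upperbound)
      show "(\<lambda>n. \<bar>(apply_lipfun (X m) (x, y) - apply_lipfun (X n) (x, y)) -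
            (apply_lipfun (X m) (x', y') - apply_lipfun (X n) (x', y'))\<bar>) \<longlonglongrightarrow>
          \<bar>(apply_lipfun (X m) (x, y) - f (x, y)) - (apply_lipfun (X m) (x', y') - f (x', y'))\<bar>"
        by (intro tendsto_intros f)
      show "\<forall>\<^sub>F n in sequentially. \<bar>(apply_lipfun (X m) (x, y) - apply_lipfun (X n) (x, y)) -
            (apply_lipfun (X m) (x', y') - apply_lipfun (X n) (x', y'))\<bar> \<le> e * (dist x x' + dist y y')"
        using eventually_ge_at_top[of N]
      proof eventually_elim
        case (elim n)
        have "norm (X m - X n) * (dist x x' + dist y y') \<le> e * (dist x x' + dist y y')"
          using N[OF m elim] by (intro mult_right_mono) auto
        then show ?case
          using lip[of "X m - X n" x y x' y'] unfolding minus by linarith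
      qed
    qed simp
    then show "sum_lipschitz e (\<lambda>z. apply_lipfun (X m) z - f z)"
      using e by (simp add: sum_lipschitz_def)
  qed
  have bl: "(\<lambda>z. apply_lipfun (X m) z - f z) \<in> blip"
    if "\<And>m n. m \<ge> N \<Longrightarrow> n \<ge> N \<Longrightarrow> norm (X m - X n) < e" "m \<ge> N" for N e m
    using close[OF that] by (auto simp: blip_def bounded_iff)
  obtain N where N: "\<And>m n. m \<ge> N \<Longrightarrow> n \<ge> N \<Longrightarrow> norm (X m - X n) < 1"
    using CauchyD[OF X zero_less_one] by blast
  have "(\<lambda>z. apply_lipfun (X N) z + - 1 * (apply_lipfun (X N) z - f z)) \<in> blip"
    by (intro blip_add blip_scale apply_lipfun bl[OF N]) auto
  then have "f \<in> blip" by simp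
  then obtain F where F: "f = apply_lipfun F"
    using apply_lipfun_cases by blast
  have "X \<longlonglongrightarrow> F"
  proof (rule metric_LIMSEQ_I)
    fix r :: real assume r: "0 < r"
    then obtain N where N: "\<And>m n. m \<ge> N \<Longrightarrow> n \<ge> N \<Longrightarrow> norm (X m - X n) < r / 3"
      using CauchyD[OF X, of "r / 3"] by auto
    have "dist (X m) F < r" if "m \<ge> N" for m
    proof -
      have "norm (X m - F) = lip_norm (\<lambda>z. apply_lipfun (X m) z - f z)"
        unfolding F by transfer simp
      also have "\<dots> \<le> r / 3 + r / 3"
        by (rule lip_norm_le) (use close[OF N that] in auto)
      finally show ?thesis using r by (simp add: dist_norm)
    qed
    then show "\<exists>N. \<forall>m\<ge>N. dist (X m) F < r" by blast
  qed
  then show "convergent X" by (auto simp: convergent_def)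
qed

end

theory Submission
  imports Defs
begin

text \<open>The value \<open>V c = inf \<integral>c d\<pi>\<close> over \<open>\<Pi>(T)\<close> is 1-Lipschitz in \<open>c\<close>, and every optimal plan for \<open>c\<close>
  is a supergradient of \<open>V\<close> at \<open>c\<close>. Hence, if for each \<open>f\<close> of a countable separating family the
  second difference \<open>V(c + \<delta>f) + V(c - \<delta>f) - 2V(c)\<close> exceeds \<open>-\<delta>/m\<close> for some \<open>\<delta> > 0\<close>, for every \<open>m\<close>,
  then all optimal plans for \<open>c\<close> coincide. For fixed \<open>f\<close> and \<open>m\<close> this is an open condition; it is
  dense because along a line the second differences of a Lipschitz function telescope. The
  separating functions are Lipschitz and nonnegative, so that \<open>c + tf\<close> stays in the cone.

  Existence of optimal plans needs weak sequential compactness of probability measures on a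
  compact metric space. A Borel injection into the reals with uniformly continuous inverse reduces
  this to Helly's selection theorem.\<close>

section \<open>Coding points of a compact metric space by real numbers\<close>

text \<open>Total boundedness gives finitely many balls of radius \<open>1 / Suc m\<close> covering
  the space; when these are enumerated for all \<open>m\<close>, each scale is exhausted by some
  finite index. The bound \<open>N\<close>, uniform in \<open>z\<close>, is what makes the decoding
  below uniformly continuous.\<close>

lemma compact_countable_balls:
  assumes "compact (UNIV :: 'z::metric_space set)"
  obtains F :: "nat \<Rightarrow> 'z::metric_space set"
  where "\<And>i. open (F i)" "\<And>e. 0 < e \<Longrightarrow> \<exists>N. \<forall>z. \<exists>i<N. z \<in> F i \<and> (\<forall>w\<in>F i. dist z w < e)"
proof -
  have "\<exists>k. finite k \<and> (UNIV :: 'z set) \<subseteq> (\<Union>x\<in>k. ball x (1 / Suc m))" for m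
    by (rule compactE_image[OF assms, of UNIV "\<lambda>x. ball x (1 / Suc m)"]) auto
  then obtain k where k: "\<And>m. finite (k m)" "\<And>m. (UNIV :: 'z set) \<subseteq> (\<Union>x\<in>k m. ball x (1 / Suc m))"
    by metis
  define \<F> where "\<F> = (\<Union>m. (\<lambda>x. ball x (1 / Suc m)) ` k m)"
  define F where "F = from_nat_into \<F>"
  have "k 0 \<noteq> {}" using k(2)[of 0] by auto
  then have ne: "\<F> \<noteq> {}" by (auto simp: \<F>_def)
  have "countable \<F>" unfolding \<F>_def using k(1) by (auto intro: countable_finite)
  with ne have rF: "range F = \<F>"
    unfolding F_def by (rule range_from_nat_into)
  show thesis
  proof (rule that)
    show "open (F i)" for i
    proof -
      have "F i \<in> \<F>" using rF by auto
      then show ?thesis by (auto simp: \<F>_def)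
    qed
    fix e :: real assume "0 < e"
    \<comment> \<open>Two points of a ball of radius below \<open>e / 2\<close> are less than
      \<open>e\<close> apart.\<close>
    then obtain m where m: "1 / Suc m < e / 2"
      using reals_Archimedean[of "e / 2"] by (auto simp: field_simps)
    have "\<forall>x\<in>k m. \<exists>i. F i = ball x (1 / Suc m)"
    proof
      fix x assume "x \<in> k m"
      then have "ball x (1 / Suc m) \<in> range F" unfolding rF \<F>_def by auto
      then show "\<exists>i. F i = ball x (1 / Suc m)" by (metis imageE)
    qed
    then obtain j where j: "\<And>x. x \<in> k m \<Longrightarrow> F (j x) = ball x (1 / Suc m)" by metis
    obtain N where N: "\<And>x. x \<in> k m \<Longrightarrow> j x < N"
      using finite_nat_bounded[of "j ` k m"] k(1) by auto
    have "\<exists>i<N. z \<in> F i \<and> (\<forall>w\<in>F i. dist z w < e)" for z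
    proof -
      obtain x where x: "x \<in> k m" "z \<in> ball x (1 / Suc m)"
        using k(2)[of m] UNIV_I[of z] by blast
      have "dist z w < e" if "w \<in> F (j x)" for w
        using that x m dist_triangle[of z w x] unfolding j[OF x(1)] by (simp add: dist_commute)
      then show ?thesis using x N j by blast
    qed
    then show "\<exists>N. \<forall>z. \<exists>i<N. z \<in> F i \<and> (\<forall>w\<in>F i. dist z w < e)" by blast
  qed
qed

text \<open>At the first index \<open>n \<le> N\<close> where the digits differ, the terms differ by
  \<open>(1 / 3) ^ n\<close>, while all later terms together contribute at most half of that. In
  base 2 the tail could cancel the leading term.\<close>

lemma ternary_code_gap:
  fixes a b :: "nat \<Rightarrow> real"
  assumes "\<And>j. a j \<in> {0, 1}" "\<And>j. b j \<in> {0, 1}" "a i \<noteq> b i" "i \<le> N"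
  shows "(1 / 3) ^ N / 2 \<le> \<bar>(\<Sum>j. a j * (1 / 3) ^ j) - (\<Sum>j. b j * (1 / 3) ^ j)\<bar>"
proof -
  define n where "n = (LEAST j. a j \<noteq> b j)"
  have n: "a n \<noteq> b n" unfolding n_def by (rule LeastI) (rule assms(3))
  have eq: "a j = b j" if "j < n" for j
    using not_less_Least[of j "\<lambda>j. a j \<noteq> b j"] that by (auto simp: n_def)
  have nN: "n \<le> N"
    using Least_le[of "\<lambda>j. a j \<noteq> b j", OF assms(3)] assms(4) by (simp add: n_def)
  define d where "d j = (a j - b j) * (1 / 3) ^ j" for j
  have ab: "\<bar>a j\<bar> \<le> 1" "\<bar>b j\<bar> \<le> 1" "\<bar>a j - b j\<bar> \<le> 1" for j
    using assms(1)[of j] assms(2)[of j] by auto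
  have sg: "summable (\<lambda>j. (1 / 3 :: real) ^ j)" by (rule summable_geometric) simp
  have summ: "summable (\<lambda>j. c j * (1 / 3 :: real) ^ j)" if "\<And>j. \<bar>c j\<bar> \<le> 1" for c
    by (rule summable_comparison_test'[OF sg, of 0])
      (use that in \<open>auto simp: abs_mult power_abs intro!: mult_left_le_one_le\<close>)
  have sd: "summable d" unfolding d_def by (rule summ) (rule ab)
  have "(\<Sum>j. a j * (1 / 3) ^ j) - (\<Sum>j. b j * (1 / 3) ^ j) = suminf d"
    unfolding d_def by (subst suminf_diff) (auto intro: summ ab simp: left_diff_distrib)
  also have "\<dots> = (\<Sum>j. d (j + Suc n)) + sum d {..<Suc n}"
    by (rule suminf_split_initial_segment[OF sd])
  also have "sum d {..<Suc n} = d n" using eq by (simp add: d_def)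
  finally have split: "(\<Sum>j. a j * (1 / 3) ^ j) - (\<Sum>j. b j * (1 / 3) ^ j) = (\<Sum>j. d (j + Suc n)) + d n" .
  have "\<bar>d n\<bar> = (1 / 3) ^ n"
    using n assms(1)[of n] assms(2)[of n] by (auto simp: d_def)
  moreover have "\<bar>\<Sum>j. d (j + Suc n)\<bar> \<le> (1 / 3) ^ n / 2"
  proof -
    have "norm (\<Sum>j. d (j + Suc n)) \<le> (\<Sum>j. (1 / 3) ^ Suc n * (1 / 3) ^ j)"
    proof (rule norm_suminf_le[OF _ summable_mult[OF sg]])
      show "norm (d (j + Suc n)) \<le> (1 / 3) ^ Suc n * (1 / 3) ^ j" for j
        using mult_right_mono[OF ab(3)[of "j + Suc n"], of "(1 / 3) ^ (j + Suc n)"]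
        by (simp add: d_def abs_mult power_abs power_add mult_ac)
    qed
    also have "\<dots> = (1 / 3) ^ n / 2"
      by (subst suminf_mult[OF sg], subst suminf_geometric) simp_all
    finally show ?thesis by simp
  qed
  moreover have "(1 / 3 :: real) ^ N \<le> (1 / 3) ^ n"
    by (rule power_decreasing[OF nN]) auto
  ultimately show ?thesis unfolding split by linarith
qed

text \<open>The ternary digits of \<open>s z\<close> record which sets \<open>F j\<close> contain
  \<open>z\<close>. Codes closer than \<open>(1 / 3) ^ N / 2\<close> agree in all digits up to
  \<open>N\<close>, so some small \<open>F i\<close> contains both points. Thus \<open>s\<close> is
  only Borel, but its inverse is uniformly continuous.\<close>

lemma compact_borel_code:
  assumes "compact (UNIV :: 'z::metric_space set)"
  obtains s :: "'z::metric_space \<Rightarrow> real"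
  where "s \<in> borel_measurable borel" "\<And>z. s z \<in> {0..2}"
    "\<And>e. 0 < e \<Longrightarrow> \<exists>d>0. \<forall>z w. dist (s z) (s w) < d \<longrightarrow> dist z w < e"
proof -
  obtain F :: "nat \<Rightarrow> 'z set" where oF: "\<And>i. open (F i)"
    and F: "\<And>e. 0 < e \<Longrightarrow> \<exists>N. \<forall>z. \<exists>i<N. z \<in> F i \<and> (\<forall>w\<in>F i. dist z w < e)"
    using compact_countable_balls[OF assms] by metis
  define s where "s z = (\<Sum>j. indicator (F j) z * (1 / 3 :: real) ^ j)" for z
  have [measurable]: "F i \<in> sets borel" for i using oF by auto
  have sg: "summable (\<lambda>j. (1 / 3 :: real) ^ j)" by (rule summable_geometric) simp
  have bnd: "indicator (F j) z * (1 / 3 :: real) ^ j \<le> (1 / 3) ^ j" for j z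
    by (auto simp: indicator_def)
  have summ: "summable (\<lambda>j. indicator (F j) z * (1 / 3 :: real) ^ j)" for z
    by (rule summable_comparison_test'[OF sg, of 0]) (use bnd in \<open>auto simp: abs_mult power_abs\<close>)
  show thesis
  proof (rule that)
    show "s \<in> borel_measurable borel" unfolding s_def by measurable
    fix z
    have "0 \<le> s z" unfolding s_def by (rule suminf_nonneg[OF summ]) auto
    moreover have "s z \<le> (\<Sum>j. (1 / 3) ^ j)"
      unfolding s_def by (rule suminf_le[OF bnd summ sg])
    ultimately show "s z \<in> {0..2}"
      using suminf_geometric[of "1 / 3 :: real"] by simp
  next
    fix e :: real assume "0 < e"
    then obtain N where N: "\<And>z. \<exists>i<N. z \<in> F i \<and> (\<forall>w\<in>F i. dist z w < e)" using F by blast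
    have "dist z w < e" if "dist (s z) (s w) < (1 / 3) ^ N / 2" for z w
    proof -
      obtain i where i: "i < N" "z \<in> F i" "\<And>w. w \<in> F i \<Longrightarrow> dist z w < e" using N by blast
      have "w \<in> F i"
      proof (rule ccontr)
        assume "w \<notin> F i"
        then have "(1 / 3) ^ N / 2 \<le> \<bar>s z - s w\<bar>"
          unfolding s_def
          by (intro ternary_code_gap[where i = i]) (use i in \<open>auto simp: indicator_def\<close>)
        then show False using that by (simp add: dist_real_def)
      qed
      then show ?thesis by (rule i)
    qed
    then show "\<exists>d>0. \<forall>z w. dist (s z) (s w) < d \<longrightarrow> dist z w < e"
      by (intro exI[of _ "(1 / 3) ^ N / 2"]) auto
  qed
qed

text \<open>Weak limits may charge limit points of the range of \<open>s\<close>, so the inverse of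
  \<open>s\<close> is extended continuously to a compact set \<open>K\<close>. The closure
  \<open>G\<close> of the graph of \<open>s\<close> is compact, and uniform continuity of the
  inverse makes \<open>fst\<close> injective on it; inverting \<open>fst\<close> and then applying
  \<open>snd\<close> gives \<open>\<phi>\<close>.\<close>

lemma compact_code_decode:
  assumes "compact (UNIV :: 'z::metric_space set)"
  obtains s :: "'z::metric_space \<Rightarrow> real" and K and \<phi> :: "real \<Rightarrow> 'z::metric_space"
  where "s \<in> borel_measurable borel" "\<And>z. s z \<in> {0..2}" "compact K" "\<And>z. s z \<in> K"
    "continuous_on K \<phi>" "\<And>z. \<phi> (s z) = z"
proof -
  obtain s :: "'z \<Rightarrow> real" where s: "s \<in> borel_measurable borel" "\<And>z. s z \<in> {0..2}"
    and sep: "\<And>e. 0 < e \<Longrightarrow> \<exists>d>0. \<forall>z w. dist (s z) (s w) < d \<longrightarrow> dist z w < e"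
    using compact_borel_code[OF assms] by metis
  define G where "G = closure (range (\<lambda>z. (s z, z)))"
  have G: "(s z, z) \<in> G" for z
    unfolding G_def by (rule closure_subset[THEN subsetD]) auto
  have "G \<subseteq> {0..2} \<times> UNIV"
    unfolding G_def by (rule closure_minimal) (use s(2) in \<open>auto intro!: closed_Times\<close>)
  moreover have "compact ({0..2::real} \<times> (UNIV :: 'z set))"
    by (intro compact_Times assms compact_Icc)
  ultimately have cG: "compact G"
    using compact_Int_closed[of "{0..2::real} \<times> (UNIV :: 'z set)" G]
    by (simp add: G_def inf.absorb2)
  have inj: "inj_on fst G"
  proof (rule inj_onI, clarsimp)
    fix x z z' assume xz: "(x, z) \<in> G" "(x, z') \<in> G"
    have "dist z z' < 3 * e" if e: "0 < e" for e
    proof -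
      obtain d where d: "d > 0" "\<And>z w. dist (s z) (s w) < d \<Longrightarrow> dist z w < e"
        using sep[OF e] by blast
      \<comment> \<open>Points of \<open>G\<close> over the same \<open>x\<close> are approximated
        by graph points whose codes lie within \<open>d / 2\<close> of \<open>x\<close>, hence
        within \<open>d\<close> of each other.\<close>
      have near: "\<exists>w. dist (s w) x < d / 2 \<and> dist w y < e" if "(x, y) \<in> G" for y
      proof -
        have "\<exists>p\<in>range (\<lambda>z. (s z, z)). dist (x, y) p < min (d / 2) e"
          using that d(1) e unfolding G_def by (intro closure_approachableD) auto
        then obtain w where "dist (s w, w) (x, y) < min (d / 2) e"
          by (auto simp only: dist_commute)
        then show ?thesis
          using dist_fst_le[of "(s w, w)" "(x, y)"] dist_snd_le[of "(s w, w)" "(x, y)"]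
          by (intro exI[of _ w]) auto
      qed
      obtain w w' where w: "dist (s w) x < d / 2" "dist w z < e" "dist (s w') x < d / 2" "dist w' z' < e"
        using near[OF xz(1)] near[OF xz(2)] by blast
      have "dist (s w) (s w') < d"
        using w dist_triangle2[of "s w" "s w'" x] by linarith
      then have "dist w w' < e" by (rule d)
      then show ?thesis
        using w dist_triangle[of z z' w] dist_triangle[of w z' w'] by (simp add: dist_commute)
    qed
    \<comment> \<open>The chain \<open>z\<close>, \<open>w\<close>, \<open>w'\<close>,
      \<open>z'\<close> has three links below \<open>e\<close>, so \<open>e = dist z z' / 3\<close>
      is contradictory for distinct points.\<close>
    from this[of "dist z z' / 3"] show "z = z'" by (cases "z = z'") auto
  qed
  show thesis
  proof (rule that[OF s])
    have cf: "continuous_on G fst" by (intro continuous_intros)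
    show "compact (fst ` G)" by (rule compact_continuous_image[OF cf cG])
    show "s z \<in> fst ` G" for z using G[of z] by force
    show "continuous_on (fst ` G) (\<lambda>x. snd (the_inv_into G fst x))"
      by (intro continuous_on_snd continuous_on_inv_into cf cG inj)
    show "snd (the_inv_into G fst (s z)) = z" for z
      using the_inv_into_f_f[OF inj G[of z]] by simp
  qed
qed

section \<open>Weak sequential compactness of probability measures\<close>

lemma prob_space_integrable_continuous:
  fixes f :: "'z::metric_space \<Rightarrow> real"
  assumes "compact (UNIV :: 'z set)" "prob_space M" "sets M = sets borel" "continuous_on UNIV f"
  shows "integrable M f"
proof -
  interpret prob_space M by fact
  obtain B where B: "\<And>z. norm (f z) \<le> B"
    using compact_imp_bounded[OF compact_continuous_image[OF assms(4,1)]]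
    by (auto simp: bounded_iff)
  have "f \<in> borel_measurable M"
    using borel_measurable_continuous_onI[OF assms(4)] measurable_cong_sets[OF assms(3) refl] by blast
  then show ?thesis using B by (intro integrable_const_bound[of _ B]) auto
qed

text \<open>Push the measures forward by \<open>s\<close> to the interval from 0 to 2, where
  tightness is immediate, take a weakly convergent subsequence of the distributions, and carry its
  limit back by \<open>\<phi>\<close>. This is possible because the limit is concentrated on
  \<open>K\<close>.\<close>

theorem compact_prob_weak_subseq:
  fixes M :: "nat \<Rightarrow> 'z::metric_space measure"
  assumes comp: "compact (UNIV :: 'z set)"
    and M: "\<And>n. prob_space (M n)" "\<And>n. sets (M n) = sets borel"
  obtains r N where "strict_mono (r :: nat \<Rightarrow> nat)" "prob_space N" "sets N = sets borel"
    "\<And>f :: 'z \<Rightarrow> real. continuous_on UNIV f \<Longrightarrow>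
       (\<lambda>n. LINT z|M (r n). f z) \<longlonglongrightarrow> (LINT z|N. f z)"
proof -
  obtain s :: "'z \<Rightarrow> real" and K \<phi> where s: "s \<in> borel_measurable borel" "\<And>z. s z \<in> {0..2}"
    and K: "compact K" "\<And>z. s z \<in> K" and \<phi>: "continuous_on K \<phi>" "\<And>z. \<phi> (s z) = z"
    using compact_code_decode[OF comp] by metis
  have sM [measurable]: "s \<in> borel_measurable (M n)" for n
    using s(1) measurable_cong_sets[OF M(2) refl] by blast
  define \<nu> where "\<nu> n = distr (M n) borel s" for n
  have rd: "real_distribution (\<nu> n)" for n
    unfolding \<nu>_def by (rule prob_space.real_distribution_distr[OF M(1) sM])
  have "tight \<nu>"
    unfolding tight_def
  proof (intro conjI allI impI rd)
    fix e :: real assume "0 < e"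
    \<comment> \<open>\<open>tight\<close> uses intervals open on the left and a code may equal 0,
      so the left end point is taken below 0.\<close>
    have "measure (\<nu> n) {-1<..2} = 1" for n
    proof -
      interpret prob_space "M n" by (rule M)
      have "s -` {-1<..2} \<inter> space (M n) = space (M n)"
        using s(2) by (force simp: less_le_trans[of "-1" 0])
      then show ?thesis unfolding \<nu>_def by (subst measure_distr) (auto simp: prob_space)
    qed
    then show "\<exists>a b. a < b \<and> (\<forall>n. 1 - e < measure (\<nu> n) {a<..b})"
      using \<open>0 < e\<close> by (intro exI[of _ "-1"] exI[of _ 2]) auto
  qed
  from tight_imp_convergent_subsubsequence[OF this strict_mono_id]
  obtain r N where r: "strict_mono r" and N: "real_distribution N" and w: "weak_conv_m (\<nu> \<circ> r) N"
    by (auto simp: o_def)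
  interpret N: real_distribution N by (rule N)
  have conv: "(\<lambda>n. LINT x|\<nu> (r n). g x) \<longlonglongrightarrow> (LINT x|N. g x)"
    if "continuous_on UNIV g" "\<And>x. norm (g x) \<le> B" for g :: "real \<Rightarrow> real" and B
    using weak_conv_imp_integral_bdd_continuous_conv[of "\<nu> \<circ> r" N g B] w N rd that
    by (auto simp: o_def continuous_on_eq_continuous_at)
  have int\<nu>: "(LINT x|\<nu> n. g x) = (LINT z|M n. g (s z))"
    if "continuous_on UNIV g" for g :: "real \<Rightarrow> real" and n
    unfolding \<nu>_def
    by (rule integral_distr[OF sM borel_measurable_continuous_onI[OF that]])
  have clK: "closed K" and neK: "K \<noteq> {}" using K by (auto simp: compact_imp_closed)
  have AE_K: "AE x in N. x \<in> K"
  proof -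
    \<comment> \<open>This bounded continuous function vanishes exactly on the closed set
      \<open>K\<close>, where all \<open>\<nu> n\<close> live, so its integral against the limit is
      also 0.\<close>
    define g where "g x = min 1 (infdist x K)" for x
    have cg: "continuous_on UNIV g" unfolding g_def by (intro continuous_intros)
    have gb: "norm (g x) \<le> 1" for x by (auto simp: g_def infdist_nonneg)
    have [measurable]: "g \<in> borel_measurable borel" by (rule borel_measurable_continuous_onI[OF cg])
    have "(LINT x|\<nu> n. g x) = 0" for n
      unfolding int\<nu>[OF cg] using K by (simp add: g_def)
    then have "(LINT x|N. g x) = 0" using conv[OF cg gb] by (simp add: LIMSEQ_const_iff)
    moreover have "integrable N g" by (rule N.integrable_const_bound[of _ 1]) (use gb in auto)
    ultimately have "AE x in N. g x = 0"
      by (subst (asm) integral_nonneg_eq_0_iff_AE) (auto simp: g_def infdist_nonneg)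
    then show ?thesis
    proof eventually_elim
      case (elim x)
      then have "infdist x K = 0" by (auto simp: g_def min_def split: if_splits)
      then show ?case using in_closed_iff_infdist_zero[OF clK neK] by simp
    qed
  qed
  \<comment> \<open>A constant value on the \<open>N\<close>-null complement of \<open>K\<close>
    makes the decoding Borel on the whole line.\<close>
  define \<psi> where "\<psi> x = (if x \<in> K then \<phi> x else undefined)" for x
  have [measurable]: "\<psi> \<in> borel_measurable borel"
    unfolding \<psi>_def using clK by (intro borel_measurable_continuous_on_if \<phi>) auto
  show thesis
  proof (rule that[OF r])
    show "prob_space (distr N borel \<psi>)" by (rule N.prob_space_distr) simp
    show "sets (distr N borel \<psi>) = sets borel" by simp
    fix f :: "'z \<Rightarrow> real" assume f: "continuous_on UNIV f"
    obtain B where B: "\<And>z. norm (f z) \<le> B"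
      using compact_imp_bounded[OF compact_continuous_image[OF f comp]] by (auto simp: bounded_iff)
    have fB: "f z \<in> cbox (- B) B" for z using B[of z] by auto
    then have ne: "cbox (- B) B \<noteq> {}" by blast
    \<comment> \<open>Weak convergence tests functions on the whole line, so the test function on
      \<open>K\<close> is extended by Tietze with the same bound.\<close>
    have "continuous_on K (\<lambda>x. f (\<phi> x))"
      by (rule continuous_on_compose2[OF f \<phi>(1)]) simp
    then obtain g where g: "continuous_on UNIV g" "\<And>x. x \<in> K \<Longrightarrow> g x = f (\<phi> x)"
      "\<And>x. x \<in> UNIV \<Longrightarrow> g x \<in> cbox (- B) B"
      using Tietze_closed_interval[of K "\<lambda>x. f (\<phi> x)" UNIV "- B" B] clK ne fB by auto
    have [measurable]: "f \<in> borel_measurable borel" "g \<in> borel_measurable borel"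
      by (auto intro: borel_measurable_continuous_onI f g)
    have "(LINT z|distr N borel \<psi>. f z) = (LINT x|N. f (\<psi> x))"
      by (rule integral_distr) auto
    also have "AE x in N. f (\<psi> x) = g x"
      using AE_K by eventually_elim (simp add: \<psi>_def g)
    then have "(LINT x|N. f (\<psi> x)) = (LINT x|N. g x)"
      by (intro integral_cong_AE) auto
    finally have "(LINT z|distr N borel \<psi>. f z) = (LINT x|N. g x)" .
    moreover have "norm (g x) \<le> B" for x using g(3)[of x] by auto
    moreover have "(LINT x|\<nu> n. g x) = (LINT z|M n. f z)" for n
      unfolding int\<nu>[OF g(1)] using K \<phi> g by simp
    ultimately show "(\<lambda>n. LINT z|M (r n). f z) \<longlonglongrightarrow> (LINT z|distr N borel \<psi>. f z)"
      using conv[OF g(1), of B] by simp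
  qed
qed

section \<open>A countable separating family of Lipschitz functions\<close>

text \<open>Finite intersections of the sets \<open>F i\<close> form a countable pi-system
  generating the Borel sets, and the indicator of a proper open set is the pointwise limit of
  truncated multiples of the distance to its complement. The integrals of these functions therefore
  determine a probability measure.\<close>

lemma compact_separating_lipschitz:
  assumes "compact (UNIV :: 'z::metric_space set)"
  obtains f :: "nat \<Rightarrow> 'z::metric_space \<Rightarrow> real"
  where "\<And>k z. f k z \<in> {0..1}" "\<And>k. \<exists>L\<ge>0. \<forall>z w. \<bar>f k z - f k w\<bar> \<le> L * dist z w"
    "\<And>M N. prob_space M \<Longrightarrow> prob_space N \<Longrightarrow> sets M = sets borel \<Longrightarrow> sets N = sets borel \<Longrightarrow>
       (\<And>k. (LINT z|M. f k z) = (LINT z|N. f k z)) \<Longrightarrow> M = N"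
proof -
  obtain F :: "nat \<Rightarrow> 'z set" where oF: "\<And>i. open (F i)"
    and F: "\<And>e. 0 < e \<Longrightarrow> \<exists>N. \<forall>z. \<exists>i<N. z \<in> F i \<and> (\<forall>w\<in>F i. dist z w < e)"
    using compact_countable_balls[OF assms] by metis
  \<comment> \<open>Appending lists intersects the sets, and the empty list yields the whole
    space.\<close>
  define W where "W I = (\<Inter>i\<in>set I. F i)" for I
  have oW: "open (W I)" for I unfolding W_def by (auto intro: oF)
  define h where "h U m z = min 1 (real m * infdist z (- U))" for U :: "'z set" and m z
  define f where "f k = (case from_nat k of (I, m) \<Rightarrow> h (W I) m)" for k
  have h01: "h U m z \<in> {0..1}" for U m z by (auto simp: h_def infdist_nonneg)
  have lip: "\<bar>h U m z - h U m w\<bar> \<le> real m * dist z w" for U m z w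
  proof -
    have "\<bar>h U m z - h U m w\<bar> \<le> \<bar>real m * infdist z (- U) - real m * infdist w (- U)\<bar>"
      unfolding h_def by linarith
    also have "\<dots> = real m * \<bar>infdist z (- U) - infdist w (- U)\<bar>"
      by (simp add: abs_mult flip: right_diff_distrib)
    also have "\<dots> \<le> real m * dist z w"
      by (intro mult_left_mono infdist_triangle_abs) auto
    finally show ?thesis .
  qed
  have conth: "continuous_on UNIV (h U m)" for U m
    unfolding h_def by (intro continuous_intros)
  \<comment> \<open>The whole space is excluded: \<open>infdist z {}\<close> is 0, so
    \<open>h UNIV m\<close> vanishes identically. Total mass settles that case later.\<close>
  have lim: "(\<lambda>m. h U m z) \<longlonglongrightarrow> indicator U z" if "open U" "U \<noteq> UNIV" for U z
  proof (cases "z \<in> U")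
    case True
    have "closed (- U)" "- U \<noteq> {}" using that by auto
    then have pos: "infdist z (- U) > 0"
      using True in_closed_iff_infdist_zero[of "- U" z] infdist_nonneg[of z "- U"] by force
    obtain m0 where m0: "1 < real m0 * infdist z (- U)" using reals_Archimedean3[OF pos] by blast
    have "\<forall>\<^sub>F m in sequentially. h U m z = 1"
      using eventually_ge_at_top[of m0]
    proof eventually_elim
      case (elim m)
      then have "real m0 * infdist z (- U) \<le> real m * infdist z (- U)"
        using pos by (intro mult_right_mono) auto
      then show ?case using m0 by (simp add: h_def)
    qed
    then show ?thesis using True by (simp add: tendsto_eventually)
  next
    case False
    then show ?thesis by (simp add: h_def)
  qed
  have meas_lim: "(\<lambda>m. LINT z|M. h U m z) \<longlonglongrightarrow> measure M U"
    if "prob_space M" and M: "sets M = sets borel" and "open U" "U \<noteq> UNIV" for M U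
  proof -
    interpret prob_space M by fact
    have "U \<in> sets M" using that by simp
    then have "measure M U = (LINT z|M. indicator U z)"
      by (simp add: sets.Int_space_eq2)
    moreover have "(\<lambda>m. LINT z|M. h U m z) \<longlonglongrightarrow> (LINT z|M. indicator U z)"
    proof (rule integral_dominated_convergence[where w = "\<lambda>_. 1"])
      show "indicator U \<in> borel_measurable M" using \<open>U \<in> sets M\<close> by simp
      show "h U m \<in> borel_measurable M" for m
        using borel_measurable_continuous_onI[OF conth] measurable_cong_sets[OF M refl] by blast
      show "AE z in M. (\<lambda>m. h U m z) \<longlonglongrightarrow> indicator U z" using lim that by simp
      show "AE z in M. norm (h U m z) \<le> 1" for m using h01[of U m] by auto
    qed simp
    ultimately show ?thesis by simp
  qed
  define E where "E = range W"
  have sig: "sets borel = sigma_sets UNIV E"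
  proof -
    have "sets (borel :: 'z measure) = sigma_sets UNIV {S. open S}"
      by (simp add: borel_def)
    also have "\<dots> = sigma_sets UNIV E"
    proof (rule sigma_sets_eqI)
      fix U :: "'z set" assume "U \<in> {S. open S}"
      then have U: "open U" by simp
      \<comment> \<open>Each point of \<open>U\<close> lies in some \<open>F i\<close> inside a ball
        within \<open>U\<close>, so \<open>U\<close> is a countable union of members of
        \<open>E\<close>.\<close>
      have "U = \<Union>(F ` {i. F i \<subseteq> U})"
      proof (intro equalityI subsetI)
        fix z assume "z \<in> U"
        then obtain e where e: "e > 0" "ball z e \<subseteq> U" using U openE by blast
        obtain i where i: "z \<in> F i" "\<forall>w\<in>F i. dist z w < e" using F[OF e(1)] by blast
        then have "F i \<subseteq> ball z e" by auto
        then show "z \<in> \<Union>(F ` {i. F i \<subseteq> U})" using e i by blast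
      qed auto
      moreover have "\<Union>(F ` {i. F i \<subseteq> U}) \<in> sigma_sets UNIV E"
      proof (rule sigma_sets_UNION)
        fix B assume "B \<in> F ` {i. F i \<subseteq> U}"
        then obtain i where "B = W [i]" by (auto simp: W_def)
        then show "B \<in> sigma_sets UNIV E" by (auto simp: E_def)
      qed simp
      ultimately show "U \<in> sigma_sets UNIV E" by simp
    next
      fix U assume "U \<in> E"
      then show "U \<in> sigma_sets UNIV {S. open S}" using oW by (auto simp: E_def)
    qed
    finally show ?thesis .
  qed
  show thesis
  proof (rule that)
    show "f k z \<in> {0..1}" for k z by (simp add: f_def h01 del: atLeastAtMost_iff split: prod.split)
    show "\<exists>L\<ge>0. \<forall>z w. \<bar>f k z - f k w\<bar> \<le> L * dist z w" for k
    proof -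
      obtain I m where "from_nat k = (I :: nat list, m :: nat)" by fastforce
      then show ?thesis using lip by (intro exI[of _ "real m"]) (simp add: f_def)
    qed
    fix M N :: "'z measure"
    assume M: "prob_space M" "sets M = sets borel" and N: "prob_space N" "sets N = sets borel"
      and eq: "\<And>k. (LINT z|M. f k z) = (LINT z|N. f k z)"
    interpret M: prob_space M by fact
    interpret N: prob_space N by fact
    have sp: "space M = UNIV" "space N = UNIV"
      using M N by (simp_all add: sets_eq_imp_space_eq)
    have eqh: "(LINT z|M. h (W I) m z) = (LINT z|N. h (W I) m z)" for I m
      using eq[of "to_nat (I, m)"] by (simp add: f_def)
    have meq: "measure M (W I) = measure N (W I)" for I
    proof (cases "W I = UNIV")
      case True
      then show ?thesis using M.prob_space N.prob_space by (simp add: sp)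
    next
      case False
      show ?thesis
        by (rule LIMSEQ_unique[OF meas_lim[OF M oW False]])
          (use meas_lim[OF N oW False] in \<open>simp add: eqh\<close>)
    qed
    show "M = N"
    proof (rule measure_eqI_generator_eq[where E = E and \<Omega> = UNIV and A = "\<lambda>_. UNIV"])
      show "Int_stable E"
      proof (rule Int_stableI)
        fix a b assume "a \<in> E" "b \<in> E"
        then obtain I J where "a = W I" "b = W J" by (auto simp: E_def)
        then have "a \<inter> b = W (I @ J)" by (auto simp: W_def)
        then show "a \<inter> b \<in> E" by (auto simp: E_def)
      qed
      show "emeasure M U = emeasure N U" if "U \<in> E" for U
        using that meq by (auto simp: E_def M.emeasure_eq_measure N.emeasure_eq_measure)
      show "range (\<lambda>_ :: nat. UNIV) \<subseteq> E"
        by (auto simp: E_def W_def intro!: image_eqI[of _ _ "[]"])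
    qed (use M N sig in auto)
  qed
qed

section \<open>Genericity from second differences\<close>

text \<open>Second differences with step \<open>\<delta>\<close> telescope, and the total is at least \<open>-2 L \<delta>\<close>.\<close>

lemma lipschitz_second_difference:
  fixes \<phi> :: "real \<Rightarrow> real"
  assumes lip: "\<And>s t. \<bar>\<phi> s - \<phi> t\<bar> \<le> L * \<bar>s - t\<bar>" and "0 < \<eta>" "0 < \<epsilon>"
  obtains t \<delta> where "0 < t" "t < \<eta>" "0 < \<delta>" "- (\<delta> * \<epsilon>) < \<phi> (t + \<delta>) + \<phi> (t - \<delta>) - 2 * \<phi> t"
proof (rule ccontr)
  assume "\<not> thesis"
  note result = that
  have neg: "\<phi> (t + \<delta>) + \<phi> (t - \<delta>) - 2 * \<phi> t \<le> - (\<delta> * \<epsilon>)"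
    if t: "0 < t" "t < \<eta>" "0 < \<delta>" for t \<delta>
    using result[OF t] \<open>\<not> thesis\<close> by (meson not_le)
  \<comment> \<open>If every second difference were at most
    \<open>- (\<delta> * \<epsilon>)\<close>, the increments would fall by
    \<open>\<delta> * \<epsilon>\<close> per step; \<open>n\<close> steps exceed the range
    \<open>2 * L * \<delta>\<close> available to an increment.\<close>
  obtain n :: nat where n: "2 * L < real n * \<epsilon>" using reals_Archimedean3[OF \<open>0 < \<epsilon>\<close>] by blast
  \<comment> \<open>Dividing by \<open>n + 1\<close> keeps the centres \<open>j * \<delta>\<close>
    with \<open>1 \<le> j \<le> n\<close> strictly between 0 and \<open>\<eta>\<close>.\<close>
  define \<delta> where "\<delta> = \<eta> / real (n + 1)"
  have \<delta>: "0 < \<delta>" using \<open>0 < \<eta>\<close> by (simp add: \<delta>_def)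
  have step: "\<phi> (real (j + 1) * \<delta>) - \<phi> (real j * \<delta>) \<le> \<phi> \<delta> - \<phi> 0 - real j * (\<delta> * \<epsilon>)" if "j \<le> n" for j
    using that
  proof (induction j)
    case (Suc j)
    have "real (Suc j) * \<delta> < \<eta>"
      using Suc.prems \<open>0 < \<eta>\<close> by (simp add: \<delta>_def field_simps)
    moreover have "0 < real (Suc j) * \<delta>" using \<delta> by simp
    ultimately have "\<phi> (real (Suc j) * \<delta> + \<delta>) + \<phi> (real (Suc j) * \<delta> - \<delta>)
        - 2 * \<phi> (real (Suc j) * \<delta>) \<le> - (\<delta> * \<epsilon>)"
      by (intro neg \<delta>)
    with Suc show ?case by (simp add: algebra_simps)
  qed simp
  have a: "- (L * \<delta>) \<le> \<phi> (real (n + 1) * \<delta>) - \<phi> (real n * \<delta>)"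
    using lip[of "real (n + 1) * \<delta>" "real n * \<delta>"] \<delta> by (simp add: algebra_simps)
  have b: "\<phi> \<delta> - \<phi> 0 \<le> L * \<delta>"
    using lip[of \<delta> 0] \<delta> by simp
  have "real n * (\<delta> * \<epsilon>) \<le> 2 * L * \<delta>"
    using step[of n] a b by (simp add: algebra_simps)
  then have "(real n * \<epsilon>) * \<delta> \<le> (2 * L) * \<delta>" by (simp add: mult_ac)
  then show False using n \<delta> by simp
qed

text \<open>Continuity of \<open>V\<close> makes each set \<open>U k m\<close> relatively open, and
  the second-difference lemma along the ray \<open>c + t *\<^sub>R f k\<close> makes it dense. Only
  these positive perturbations have to stay in \<open>C\<close>: since \<open>V\<close> is defined
  everywhere, \<open>c - \<delta> *\<^sub>R f k\<close> may leave it.\<close>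

lemma generic_in_directional:
  fixes V :: "'v::real_normed_vector \<Rightarrow> real" and f :: "nat \<Rightarrow> 'v"
  assumes C: "\<And>c k t. c \<in> C \<Longrightarrow> 0 < t \<Longrightarrow> c + t *\<^sub>R f k \<in> C"
    and lip: "\<And>c d. \<bar>V c - V d\<bar> \<le> norm (c - d)"
    and "S \<subseteq> C"
    and S: "\<And>c. c \<in> C \<Longrightarrow> (\<And>k m. \<exists>\<delta>>0. - (\<delta> * (1 / real (Suc m))) <
        V (c + \<delta> *\<^sub>R f k) + V (c - \<delta> *\<^sub>R f k) - 2 * V c) \<Longrightarrow> c \<in> S"
  shows "generic_in (top_of_set C) S"
proof -
  define W where "W k m \<delta> = {c. - (\<delta> * (1 / real (Suc m))) <
        V (c + \<delta> *\<^sub>R f k) + V (c - \<delta> *\<^sub>R f k) - 2 * V c}" for k m \<delta>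
  define U where "U k m = C \<inter> (\<Union>\<delta>\<in>{0<..}. W k m \<delta>)" for k m
  have "1-lipschitz_on UNIV V"
    by (rule lipschitz_onI) (use lip in \<open>auto simp: dist_norm\<close>)
  then have cV: "continuous_on UNIV V" by (rule lipschitz_on_continuous_on)
  have oW: "open (W k m \<delta>)" for k m \<delta>
    unfolding W_def
    by (intro open_Collect_less continuous_intros continuous_on_compose2[OF cV]) auto
  then have oU: "openin (top_of_set C) (U k m)" for k m
    unfolding U_def by (intro openin_open_Int open_UN ballI oW)
  have dense: "(top_of_set C) closure_of (U k m) = C" for k m
  proof -
    have "c \<in> (top_of_set C) closure_of (U k m)" if c: "c \<in> C" for c
      unfolding in_closure_of
    proof (intro conjI allI impI)
      show "c \<in> topspace (top_of_set C)" using c by simp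
      fix T assume "c \<in> T \<and> openin (top_of_set C) T"
      then obtain e where e: "e > 0" "ball c e \<inter> C \<subseteq> T"
        by (auto simp: openin_contains_ball)
      \<comment> \<open>A positive \<open>t < \<eta>\<close> moves \<open>c\<close> by less than
        \<open>e\<close>; the summand 1 covers the case \<open>f k = 0\<close>.\<close>
      define \<eta> where "\<eta> = e / (norm (f k) + 1)"
      have "norm (f k) + 1 > 0" using norm_ge_zero[of "f k"] by linarith
      then have \<eta>: "\<eta> > 0" "\<eta> * (norm (f k) + 1) = e"
        using e(1) by (simp_all add: \<eta>_def)
      have "\<bar>V (c + s *\<^sub>R f k) - V (c + t *\<^sub>R f k)\<bar> \<le> norm (f k) * \<bar>s - t\<bar>" for s t
        using lip[of "c + s *\<^sub>R f k" "c + t *\<^sub>R f k"]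
        by (simp add: mult.commute flip: scaleR_left_diff_distrib)
      then obtain t \<delta> where t: "0 < t" "t < \<eta>" "0 < \<delta>" "- (\<delta> * (1 / real (Suc m))) <
          V (c + (t + \<delta>) *\<^sub>R f k) + V (c + (t - \<delta>) *\<^sub>R f k) - 2 * V (c + t *\<^sub>R f k)"
        using lipschitz_second_difference[of "\<lambda>t. V (c + t *\<^sub>R f k)" "norm (f k)" \<eta> "1 / real (Suc m)"] \<eta>(1)
        by (metis of_nat_0_less_iff zero_less_Suc zero_less_divide_1_iff)
      let ?c = "c + t *\<^sub>R f k"
      have "?c \<in> W k m \<delta>"
        using t(4) by (simp add: W_def algebra_simps)
      then have "?c \<in> U k m" using t C[OF c] by (auto simp: U_def)
      moreover have "?c \<in> T"
      proof -
        have "t * norm (f k) \<le> \<eta> * norm (f k)" using t by (intro mult_right_mono) auto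
        then have "dist c ?c < e" using t \<eta> by (simp add: dist_norm algebra_simps)
        then show ?thesis using e C[OF c t(1)] by auto
      qed
      ultimately show "\<exists>y. y \<in> U k m \<and> y \<in> T" by blast
    qed
    then show ?thesis using closure_of_subset_topspace[of "top_of_set C" "U k m"] by auto
  qed
  show ?thesis
    unfolding generic_in_def
  proof (intro conjI exI[of _ "range (\<lambda>(k, m). U k m)"])
    show "topspace (top_of_set C) \<inter> \<Inter> (range (\<lambda>(k, m). U k m)) \<subseteq> S"
    proof
      fix c assume "c \<in> topspace (top_of_set C) \<inter> \<Inter> (range (\<lambda>(k, m). U k m))"
      then have c: "c \<in> C" "\<And>k m. c \<in> U k m" by auto
      show "c \<in> S"
        by (rule S[OF c(1)]) (use c(2) in \<open>auto simp: U_def W_def\<close>)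
    qed
  qed (use assms(3) oU dense in auto)
qed

section \<open>Existence of invariant measures\<close>

text \<open>The Krylov-Bogoliubov argument: a weak limit of the averages over an orbit is invariant.\<close>

theorem compact_invariant_prob_exists:
  fixes T :: "'z::metric_space \<Rightarrow> 'z"
  assumes comp: "compact (UNIV :: 'z set)" and T: "continuous_on UNIV T"
  obtains M where "prob_space M" "sets M = sets borel"
    "\<And>f :: 'z \<Rightarrow> real. continuous_on UNIV f \<Longrightarrow> (LINT z|M. f z) = (LINT z|M. f (T z))"
proof -
  \<comment> \<open>\<open>undefined\<close> serves as an arbitrary starting point of the
    orbit.\<close>
  define x where "x k = (T ^^ k) undefined" for k
  \<comment> \<open>\<open>M n\<close> is the empirical measure of the orbit; \<open>Suc n\<close>
    keeps the set of times nonempty.\<close>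
  define M where "M n = distr (measure_pmf (pmf_of_set {..<Suc n})) borel x" for n
  have "prob_space (M n)" for n
    unfolding M_def by (rule prob_space.prob_space_distr[OF prob_space_measure_pmf]) simp
  moreover have "sets (M n) = sets borel" for n by (simp add: M_def)
  ultimately obtain r N where r: "strict_mono (r :: nat \<Rightarrow> nat)" and N: "prob_space N" "sets N = sets borel"
    and lim: "\<And>f :: 'z \<Rightarrow> real. continuous_on UNIV f \<Longrightarrow>
       (\<lambda>n. LINT z|M (r n). f z) \<longlonglongrightarrow> (LINT z|N. f z)"
    using compact_prob_weak_subseq[OF comp, of M] by metis
  have int: "(LINT z|M n. f z) = (\<Sum>k<Suc n. f (x k)) / real (Suc n)"
    if "continuous_on UNIV f" for f :: "'z \<Rightarrow> real" and n
  proof -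
    have "(LINT z|M n. f z) = (LINT k|measure_pmf (pmf_of_set {..<Suc n}). f (x k))"
      unfolding M_def by (rule integral_distr) (auto intro: borel_measurable_continuous_onI that)
    then show ?thesis
      by (subst (asm) integral_pmf_of_set) (auto simp del: sum.lessThan_Suc)
  qed
  show thesis
  proof (rule that[OF N])
    fix f :: "'z \<Rightarrow> real" assume f: "continuous_on UNIV f"
    have fT: "continuous_on UNIV (\<lambda>z. f (T z))"
      by (rule continuous_on_compose2[OF f T]) simp
    obtain B where B: "\<And>z. \<bar>f z\<bar> \<le> B"
      using compact_imp_bounded[OF compact_continuous_image[OF f comp]] by (auto simp: bounded_iff)
    have bound: "norm ((LINT z|M n. f (T z)) - (LINT z|M n. f z)) \<le> 2 * B / real (Suc n)" for n
    proof -
      have "(LINT z|M n. f (T z)) - (LINT z|M n. f z) =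
          (\<Sum>k<Suc n. f (x (Suc k)) - f (x k)) / real (Suc n)"
        unfolding int[OF f] int[OF fT] by (simp add: x_def sum_subtractf diff_divide_distrib)
      \<comment> \<open>Applying \<open>T\<close> shifts the orbit sum by one, so only the two end
        terms survive.\<close>
      also have "\<dots> = (f (x (Suc n)) - f (x 0)) / real (Suc n)"
        by (subst sum_lessThan_telescope) simp
      finally show ?thesis
        using B[of "x (Suc n)"] B[of "x 0"] by (auto simp: abs_le_iff intro!: divide_right_mono)
    qed
    have "(\<lambda>n. 2 * B / real (Suc n)) \<longlonglongrightarrow> 0"
      using tendsto_mult[OF tendsto_const[of "2 * B"] LIMSEQ_inverse_real_of_nat]
      by (simp add: divide_inverse)
    from Lim_null_comparison[OF always_eventually[OF allI[OF bound]] this]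
    have "(\<lambda>n. (LINT z|M n. f (T z)) - (LINT z|M n. f z)) \<longlonglongrightarrow> 0" .
    from LIMSEQ_subseq_LIMSEQ[OF this r]
    have "(\<lambda>n. (LINT z|M (r n). f (T z)) - (LINT z|M (r n). f z)) \<longlonglongrightarrow> 0"
      by (simp add: o_def)
    moreover have "(\<lambda>n. (LINT z|M (r n). f (T z)) - (LINT z|M (r n). f z))
        \<longlonglongrightarrow> (LINT z|N. f (T z)) - (LINT z|N. f z)"
      by (intro tendsto_diff lim f fT)
    ultimately show "(LINT z|N. f z) = (LINT z|N. f (T z))"
      using LIMSEQ_unique by fastforce
  qed
qed

section \<open>Optimal plans and the value function\<close>

text \<open>This is \<open>V\<close> of the outline, defined for all real costs because the downward
  perturbations \<open>c - \<delta> f\<close> may become negative.\<close>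

definition plan_value ::
    "('a::metric_space \<times> 'b::metric_space \<Rightarrow> 'a) \<Rightarrow> ('a \<times> 'b \<Rightarrow> 'b) \<Rightarrow> ('a \<times> 'b \<Rightarrow> real) \<Rightarrow> real"
  where "plan_value T1 T2 c = (INF \<pi>\<in>invariant_plans T1 T2. LINT z|\<pi>. c z)"

context
  fixes T1 :: "'a::metric_space \<times> 'b::metric_space \<Rightarrow> 'a"
    and T2 :: "'a \<times> 'b \<Rightarrow> 'b"
  assumes compX: "compact (UNIV :: 'a set)" and compY: "compact (UNIV :: 'b set)"
    and T1: "continuous_on UNIV T1" and T2: "continuous_on UNIV T2"
begin

lemma compact_product: "compact (UNIV :: ('a \<times> 'b) set)"
  using compact_Times[OF compX compY] by simp

lemma plan_integrable:
  fixes c :: "'a \<times> 'b \<Rightarrow> real"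
  assumes "\<pi> \<in> invariant_plans T1 T2" "continuous_on UNIV c"
  shows "integrable \<pi> c"
  using prob_space_integrable_continuous[OF compact_product] assms
  by (auto simp: invariant_plans_def)

text \<open>An invariant measure of the map \<open>z \<mapsto> (T1 z, T2 z)\<close> is a plan, as
  testing on functions of one coordinate shows. Nonemptiness gives the real infimum its
  meaning.\<close>

lemma plans_nonempty: "invariant_plans T1 T2 \<noteq> {}"
proof -
  have "continuous_on UNIV (\<lambda>z. (T1 z, T2 z))" by (intro continuous_intros T1 T2)
  then obtain M where M: "prob_space M" "sets M = sets borel"
    "\<And>f :: 'a \<times> 'b \<Rightarrow> real. continuous_on UNIV f \<Longrightarrow> (LINT z|M. f z) = (LINT z|M. f (T1 z, T2 z))"
    using compact_invariant_prob_exists[OF compact_product] by metis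
  have "(LINT z|M. f (fst z)) = (LINT z|M. f (T1 z))"
    if "continuous_on UNIV f" for f :: "'a \<Rightarrow> real"
    using M(3)[of "\<lambda>z. f (fst z)"] continuous_on_compose2[OF that, of UNIV fst]
    by (simp add: continuous_on_fst continuous_on_id)
  moreover have "(LINT z|M. g (snd z)) = (LINT z|M. g (T2 z))"
    if "continuous_on UNIV g" for g :: "'b \<Rightarrow> real"
    using M(3)[of "\<lambda>z. g (snd z)"] continuous_on_compose2[OF that, of UNIV snd]
    by (simp add: continuous_on_snd continuous_on_id)
  ultimately have "M \<in> invariant_plans T1 T2"
    using M by (simp add: invariant_plans_def)
  then show ?thesis by blast
qed

lemma plan_value_lower:
  assumes "continuous_on UNIV c" "\<pi> \<in> invariant_plans T1 T2"
  shows "plan_value T1 T2 c \<le> (LINT z|\<pi>. c z)"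
  unfolding plan_value_def
proof (rule cINF_lower[OF _ assms(2)])
  \<comment> \<open>The infimum is a lower bound once the family is bounded below; compactness
    provides the bound.\<close>
  obtain B where B: "\<And>z. \<bar>c z\<bar> \<le> B"
    using compact_imp_bounded[OF compact_continuous_image[OF assms(1) compact_product]]
    by (auto simp: bounded_iff)
  have "- B \<le> (LINT z|\<pi>. c z)" if "\<pi> \<in> invariant_plans T1 T2" for \<pi>
  proof -
    interpret prob_space \<pi> using that by (simp add: invariant_plans_def)
    show ?thesis
      using integral_ge_const[OF plan_integrable[OF that assms(1)], of "- B"] B
      by (simp add: abs_le_iff minus_le_iff)
  qed
  then show "bdd_below ((\<lambda>\<pi>. LINT z|\<pi>. c z) ` invariant_plans T1 T2)"
    by (auto simp: bdd_below_def)
qed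

text \<open>Plans have mass 1, so adding \<open>B\<close> to the cost adds \<open>B\<close> to every
  integral. Used in both directions with \<open>B = norm (c - d)\<close>, this is the 1-Lipschitz
  bound for the value.\<close>

lemma plan_value_le_add:
  assumes "continuous_on UNIV c" "continuous_on UNIV d" "\<And>z. c z \<le> d z + B"
  shows "plan_value T1 T2 c \<le> plan_value T1 T2 d + B"
proof -
  have "plan_value T1 T2 c - B \<le> (LINT z|\<pi>. d z)" if \<pi>: "\<pi> \<in> invariant_plans T1 T2" for \<pi>
  proof -
    interpret prob_space \<pi> using \<pi> by (simp add: invariant_plans_def)
    have "(LINT z|\<pi>. c z) \<le> (LINT z|\<pi>. d z + B)"
      using assms plan_integrable[OF \<pi>] by (intro integral_mono) auto
    also have "\<dots> = (LINT z|\<pi>. d z) + B"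
      using plan_integrable[OF \<pi> assms(2)] by (simp add: prob_space)
    finally show ?thesis using plan_value_lower[OF assms(1) \<pi>] by simp
  qed
  then have "plan_value T1 T2 c - B \<le> plan_value T1 T2 d"
    unfolding plan_value_def[of T1 T2 d] by (intro cINF_greatest plans_nonempty)
  then show ?thesis by simp
qed

text \<open>Direct method: the constraints and the cost are integrals of continuous functions, so a
  weak limit of a minimizing sequence of plans is again a plan and attains the infimum.\<close>

lemma optimal_plan_exists:
  assumes "continuous_on UNIV c"
  obtains \<pi> where "optimal_plan T1 T2 c \<pi>"
proof -
  have "\<exists>\<pi>\<in>invariant_plans T1 T2. (LINT z|\<pi>. c z) < plan_value T1 T2 c + 1 / real (Suc n)" for n
  proof (rule ccontr)
    assume "\<not> ?thesis"
    then have "plan_value T1 T2 c + 1 / real (Suc n) \<le> plan_value T1 T2 c"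
      unfolding plan_value_def[of T1 T2 c] by (intro cINF_greatest plans_nonempty) (auto simp: not_less)
    then show False by simp
  qed
  then obtain M where M: "\<And>n. M n \<in> invariant_plans T1 T2"
    and Mc: "\<And>n. (LINT z|M n. c z) < plan_value T1 T2 c + 1 / real (Suc n)"
    by metis
  have "prob_space (M n)" "sets (M n) = sets borel" for n
    using M[of n] by (auto simp: invariant_plans_def)
  then obtain r \<pi> where r: "strict_mono (r :: nat \<Rightarrow> nat)" and \<pi>: "prob_space \<pi>" "sets \<pi> = sets borel"
    and lim: "\<And>f :: 'a \<times> 'b \<Rightarrow> real. continuous_on UNIV f \<Longrightarrow>
       (\<lambda>n. LINT z|M (r n). f z) \<longlonglongrightarrow> (LINT z|\<pi>. f z)"
    using compact_prob_weak_subseq[OF compact_product, of M] by metis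
  have "(LINT z|\<pi>. f (fst z)) = (LINT z|\<pi>. f (T1 z))"
    if f: "continuous_on UNIV f" for f :: "'a \<Rightarrow> real"
  proof (rule LIMSEQ_unique)
    show "(\<lambda>n. LINT z|M (r n). f (fst z)) \<longlonglongrightarrow> (LINT z|\<pi>. f (fst z))"
      by (intro lim continuous_on_compose2[OF f] continuous_intros) auto
    have "(\<lambda>n. LINT z|M (r n). f (T1 z)) \<longlonglongrightarrow> (LINT z|\<pi>. f (T1 z))"
      by (intro lim continuous_on_compose2[OF f T1]) auto
    moreover have "(LINT z|M n. f (fst z)) = (LINT z|M n. f (T1 z))" for n
      using M[of n] f by (auto simp: invariant_plans_def)
    ultimately show "(\<lambda>n. LINT z|M (r n). f (fst z)) \<longlonglongrightarrow> (LINT z|\<pi>. f (T1 z))" by simp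
  qed
  moreover have "(LINT z|\<pi>. g (snd z)) = (LINT z|\<pi>. g (T2 z))"
    if g: "continuous_on UNIV g" for g :: "'b \<Rightarrow> real"
  proof (rule LIMSEQ_unique)
    show "(\<lambda>n. LINT z|M (r n). g (snd z)) \<longlonglongrightarrow> (LINT z|\<pi>. g (snd z))"
      by (intro lim continuous_on_compose2[OF g] continuous_intros) auto
    have "(\<lambda>n. LINT z|M (r n). g (T2 z)) \<longlonglongrightarrow> (LINT z|\<pi>. g (T2 z))"
      by (intro lim continuous_on_compose2[OF g T2]) auto
    moreover have "(LINT z|M n. g (snd z)) = (LINT z|M n. g (T2 z))" for n
      using M[of n] g by (auto simp: invariant_plans_def)
    ultimately show "(\<lambda>n. LINT z|M (r n). g (snd z)) \<longlonglongrightarrow> (LINT z|\<pi>. g (T2 z))" by simp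
  qed
  ultimately have \<pi>_plan: "\<pi> \<in> invariant_plans T1 T2"
    using \<pi> by (simp add: invariant_plans_def)
  have "(\<lambda>n. plan_value T1 T2 c + 1 / real (Suc n)) \<longlonglongrightarrow> plan_value T1 T2 c + 0"
    using LIMSEQ_inverse_real_of_nat by (intro tendsto_intros) (simp add: divide_inverse)
  from LIMSEQ_le[OF lim[OF assms] LIMSEQ_subseq_LIMSEQ[OF this r]]
  have "(LINT z|\<pi>. c z) \<le> plan_value T1 T2 c + 0"
    using Mc by (auto intro: less_imp_le)
  with plan_value_lower[OF assms \<pi>_plan] have "(LINT z|\<pi>. c z) = plan_value T1 T2 c" by simp
  then show thesis
    using that \<pi>_plan by (simp add: optimal_plan_def plan_value_def)
qed

text \<open>Each optimal plan bounds the value along \<open>c + t f\<close> by an affine function of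
  \<open>t\<close> whose slope is its integral of \<open>f\<close>. Two different slopes would force
  a concave kink at \<open>c\<close>, with second differences at most a negative constant times
  \<open>\<delta>\<close>, which \<open>flat\<close> rules out.\<close>

lemma optimal_plans_agree:
  fixes c f :: "'a \<times> 'b \<Rightarrow> real"
  assumes c: "continuous_on UNIV c" and f: "continuous_on UNIV f"
    and flat: "\<And>m. \<exists>\<delta>>0. - (\<delta> * (1 / real (Suc m))) < plan_value T1 T2 (\<lambda>z. c z + \<delta> * f z)
        + plan_value T1 T2 (\<lambda>z. c z + - \<delta> * f z) - 2 * plan_value T1 T2 c"
    and opt: "optimal_plan T1 T2 c \<pi>" "optimal_plan T1 T2 c \<pi>'"
  shows "(LINT z|\<pi>. f z) = (LINT z|\<pi>'. f z)"
proof -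
  have upper: "plan_value T1 T2 (\<lambda>z. c z + t * f z) \<le> plan_value T1 T2 c + t * (LINT z|\<rho>. f z)"
    if "optimal_plan T1 T2 c \<rho>" for \<rho> t
  proof -
    have \<rho>: "\<rho> \<in> invariant_plans T1 T2" "(LINT z|\<rho>. c z) = plan_value T1 T2 c"
      using that by (auto simp: optimal_plan_def plan_value_def)
    have "plan_value T1 T2 (\<lambda>z. c z + t * f z) \<le> (LINT z|\<rho>. c z + t * f z)"
      by (intro plan_value_lower \<rho> continuous_intros c f)
    also have "\<dots> = plan_value T1 T2 c + t * (LINT z|\<rho>. f z)"
      using plan_integrable[OF \<rho>(1) c] plan_integrable[OF \<rho>(1) f] by (simp add: \<rho>(2))
    finally show ?thesis .
  qed
  have le: "(LINT z|\<rho>'. f z) \<le> (LINT z|\<rho>. f z)"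
    if \<rho>: "optimal_plan T1 T2 c \<rho>" "optimal_plan T1 T2 c \<rho>'" for \<rho> \<rho>'
  proof (rule ccontr)
    assume "\<not> ?thesis"
    then obtain m where m: "1 / real (Suc m) < (LINT z|\<rho>'. f z) - (LINT z|\<rho>. f z)"
      using reals_Archimedean[of "(LINT z|\<rho>'. f z) - (LINT z|\<rho>. f z)"] by (auto simp: inverse_eq_divide)
    obtain \<delta> where \<delta>: "\<delta> > 0" "- (\<delta> * (1 / real (Suc m))) < plan_value T1 T2 (\<lambda>z. c z + \<delta> * f z)
        + plan_value T1 T2 (\<lambda>z. c z + - \<delta> * f z) - 2 * plan_value T1 T2 c"
      using flat by blast
    \<comment> \<open>\<open>\<rho>\<close> is used for the step \<open>\<delta>\<close> and
      \<open>\<rho>'\<close> for \<open>- \<delta>\<close>, so that the difference of slopes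
      survives in the sum.\<close>
    have "\<delta> * ((LINT z|\<rho>'. f z) - (LINT z|\<rho>. f z)) < \<delta> * (1 / real (Suc m))"
      using \<delta>(2) upper[OF \<rho>(1), of \<delta>] upper[OF \<rho>(2), of "- \<delta>"] by (simp add: algebra_simps)
    then show False using m \<delta>(1) by (simp only: mult_less_cancel_left_pos)
  qed
  show ?thesis using le opt by (intro antisym)
qed

text \<open>Both function spaces enter through their evaluation map \<open>ev\<close>.\<close>

lemma generic_unique_optimal_plan:
  fixes ev :: "'v::real_normed_vector \<Rightarrow> 'a \<times> 'b \<Rightarrow> real" and g :: "nat \<Rightarrow> 'v"
  assumes ev: "\<And>c. continuous_on UNIV (ev c)"
    and ev_add: "\<And>c d t z. ev (c + t *\<^sub>R d) z = ev c z + t * ev d z"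
    and ev_norm: "\<And>c z. \<bar>ev c z\<bar> \<le> norm c"
    and C: "\<And>c k t. c \<in> C \<Longrightarrow> 0 < t \<Longrightarrow> c + t *\<^sub>R g k \<in> C"
    and separating: "\<And>M N. prob_space M \<Longrightarrow> prob_space N \<Longrightarrow> sets M = sets borel \<Longrightarrow>
       sets N = sets borel \<Longrightarrow> (\<And>k. (LINT z|M. ev (g k) z) = (LINT z|N. ev (g k) z)) \<Longrightarrow> M = N"
  shows "generic_in (top_of_set C) {c \<in> C. \<exists>!\<pi>. optimal_plan T1 T2 (ev c) \<pi>}"
proof (rule generic_in_directional[where V = "\<lambda>c. plan_value T1 T2 (ev c)" and f = g])
  show "c + t *\<^sub>R g k \<in> C" if "c \<in> C" "0 < t" for c k t by (rule C[OF that])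
  show "\<bar>plan_value T1 T2 (ev c) - plan_value T1 T2 (ev d)\<bar> \<le> norm (c - d)" for c d
  proof -
    have "\<bar>ev c z - ev d z\<bar> \<le> norm (c - d)" for z
      using ev_add[of c "-1" d z] ev_norm[of "c - d" z] by simp
    then have "ev c z \<le> ev d z + norm (c - d)" "ev d z \<le> ev c z + norm (c - d)" for z
      by (simp_all add: abs_le_iff algebra_simps)
    then show ?thesis
      using plan_value_le_add[OF ev ev, of c d "norm (c - d)"]
        plan_value_le_add[OF ev ev, of d c "norm (c - d)"] by (simp add: abs_le_iff)
  qed
  show "{c \<in> C. \<exists>!\<pi>. optimal_plan T1 T2 (ev c) \<pi>} \<subseteq> C" by blast
  fix c assume c: "c \<in> C"
    and flat: "\<And>k m. \<exists>\<delta>>0. - (\<delta> * (1 / real (Suc m))) < plan_value T1 T2 (ev (c + \<delta> *\<^sub>R g k))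
       + plan_value T1 T2 (ev (c - \<delta> *\<^sub>R g k)) - 2 * plan_value T1 T2 (ev c)"
  have ev_eq: "ev (c + t *\<^sub>R d) = (\<lambda>z. ev c z + t * ev d z)"
    "ev (c - t *\<^sub>R d) = (\<lambda>z. ev c z + - t * ev d z)" for t d
    using ev_add[of c t d] ev_add[of c "- t" d] by auto
  \<comment> \<open>Two optimal plans give every \<open>ev (g k)\<close> the same integral and are
    therefore equal; existence comes separately from the direct method.\<close>
  have "\<pi> = \<pi>'" if opt: "optimal_plan T1 T2 (ev c) \<pi>" "optimal_plan T1 T2 (ev c) \<pi>'" for \<pi> \<pi>'
  proof (rule separating)
    show "(LINT z|\<pi>. ev (g k) z) = (LINT z|\<pi>'. ev (g k) z)" for k
      by (rule optimal_plans_agree[OF ev ev _ opt]) (rule flat[of _ k, unfolded ev_eq])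
  qed (use opt in \<open>auto simp: optimal_plan_def invariant_plans_def\<close>)
  moreover obtain \<pi> where "optimal_plan T1 T2 (ev c) \<pi>"
    using optimal_plan_exists[OF ev] by blast
  ultimately show "c \<in> {c \<in> C. \<exists>!\<pi>. optimal_plan T1 T2 (ev c) \<pi>}"
    using c by blast
qed

end

section \<open>Application to the two function spaces\<close>

theorem proposition14:
  fixes T1 :: "'a::metric_space \<times> 'b::metric_space \<Rightarrow> 'a"
    and T2 :: "'a \<times> 'b \<Rightarrow> 'b"
  assumes "compact (UNIV :: 'a set)"
    and "compact (UNIV :: 'b set)"
    and "continuous_on UNIV T1"
    and "continuous_on UNIV T2"
  shows "generic_in (top_of_set nonneg_contfun)
           {c \<in> nonneg_contfun. \<exists>!\<pi>. optimal_plan T1 T2 (apply_bcontfun c) \<pi>}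
       \<and> generic_in euclidean
           {c :: ('a, 'b) lipfun. \<exists>!\<pi>. optimal_plan T1 T2 (apply_lipfun c) \<pi>}"
proof -
  \<comment> \<open>One family gives the directions in both spaces: its nonnegativity preserves the
    cone, and its Lipschitz bounds give membership in \<open>blip\<close>.\<close>
  have "compact (UNIV :: ('a \<times> 'b) set)"
    using compact_Times[OF assms(1,2)] by simp
  then obtain f :: "nat \<Rightarrow> 'a \<times> 'b \<Rightarrow> real"
    where f01: "\<And>k z. f k z \<in> {0..1}"
      and lip: "\<And>k. \<exists>L\<ge>0. \<forall>z w. \<bar>f k z - f k w\<bar> \<le> L * dist z w"
      and separating: "\<And>M N. prob_space M \<Longrightarrow> prob_space N \<Longrightarrow> sets M = sets borel \<Longrightarrow>
        sets N = sets borel \<Longrightarrow> (\<And>k. (LINT z|M. f k z) = (LINT z|N. f k z)) \<Longrightarrow> M = N"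
    using compact_separating_lipschitz by metis
  have fblip: "f k \<in> blip" for k
  proof -
    obtain L where L: "L \<ge> 0" "\<And>z w. \<bar>f k z - f k w\<bar> \<le> L * dist z w" using lip by blast
    \<comment> \<open>The metric of the product type is Euclidean and bounded by the sum metric, so
      the Lipschitz constant carries over.\<close>
    have "dist (x, y) (x', y') \<le> dist x x' + dist y y'" for x x' :: 'a and y y' :: 'b
      unfolding dist_Pair_Pair by (rule sqrt_sum_squares_le_sum) auto
    then have "\<bar>f k (x, y) - f k (x', y')\<bar> \<le> L * (dist x x' + dist y y')" for x x' y y'
      using L(2)[of "(x, y)" "(x', y')"] mult_left_mono[OF _ L(1)] order_trans by blast
    then have "sum_lipschitz L (f k)" using L(1) by (simp add: sum_lipschitz_def)
    then show ?thesis using blip_compact[OF assms(1,2)] by blast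
  qed
  have fcont: "f k \<in> bcontfun" for k
    using fblip[of k] sum_lipschitz_continuous bcontfun_compact[OF assms(1,2)]
    by (auto simp: blip_def)
  have ev_Lip: "apply_lipfun (Lipfun (f k)) = f k" for k
    by (rule Lipfun_inverse[OF fblip])
  have ev_B: "apply_bcontfun (Bcontfun (f k)) = f k" for k
    by (rule Bcontfun_inverse[OF fcont])
  have "generic_in (top_of_set nonneg_contfun)
      {c \<in> nonneg_contfun. \<exists>!\<pi>. optimal_plan T1 T2 (apply_bcontfun c) \<pi>}"
  proof (rule generic_unique_optimal_plan[OF assms, where g = "\<lambda>k. Bcontfun (f k)"])
    show "continuous_on UNIV (apply_bcontfun c)" for c :: "('a \<times> 'b) \<Rightarrow>\<^sub>C real"
      using apply_bcontfun[of c] by (simp add: bcontfun_def)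
    show "\<bar>apply_bcontfun c z\<bar> \<le> norm c" for c :: "('a \<times> 'b) \<Rightarrow>\<^sub>C real" and z
      using norm_bounded[of c z] by simp
    show "c + t *\<^sub>R Bcontfun (f k) \<in> nonneg_contfun" if "c \<in> nonneg_contfun" "0 < t" for c k t
      using that f01 by (auto simp: nonneg_contfun_def ev_B plus_bcontfun.rep_eq scaleR_bcontfun.rep_eq)
  qed (use separating in \<open>simp_all add: ev_B plus_bcontfun.rep_eq scaleR_bcontfun.rep_eq\<close>)
  \<comment> \<open>Lipschitz costs carry no sign condition, so \<open>C\<close> is the whole space,
    and \<open>top_of_set UNIV\<close> is \<open>euclidean\<close>.\<close>
  moreover have "generic_in (top_of_set UNIV)
      {c \<in> UNIV :: ('a, 'b) lipfun set. \<exists>!\<pi>. optimal_plan T1 T2 (apply_lipfun c) \<pi>}"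
  proof (rule generic_unique_optimal_plan[OF assms, where g = "\<lambda>k. Lipfun (f k)"])
    show "continuous_on UNIV (apply_lipfun c)" for c :: "('a, 'b) lipfun"
      using apply_lipfun[of c] sum_lipschitz_continuous by (auto simp: blip_def)
    show "\<bar>apply_lipfun c z\<bar> \<le> norm c" for c :: "('a, 'b) lipfun" and z
      unfolding norm_lipfun.rep_eq by (rule abs_le_lip_norm[OF apply_lipfun])
  qed (use separating in \<open>simp_all add: ev_Lip plus_lipfun.rep_eq scaleR_lipfun.rep_eq\<close>)
  ultimately show ?thesis by simp
qed

end
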